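(* Let $1\le p\le d$ and $r\ge 1$ be integers, let $\mathcal U\subset\mathbb R^r$ be a finite set, and let $A\in\mathbb R^{d\times d}$, $B\in\mathbb R^{d\times r}$. Consider the system $$x(k+1)=Ax(k)+Bu(k),\qquad y(k)=\lfloor \pi_p x(k)\rfloor,\qquad u(k)\in\mathcal U .$$ Suppose that the entries of $A$ form an algebraically independent set. Then the system is uniformly left D-invertible if and only if it is uniformly left invertible. Consequently, for every $B$ and every finite $\mathcal U$, if $\mathbb S(B,\mathcal U)$ (respectively $\mathbb S_D(B,\mathcal U)$) denotes the set of matrices $A\in\mathbb R^{d\times d}$ for which the system is uniformly left invertible (respectively uniformly left D-invertible), then $\mathbb S(B,\mathcal U)\setminus\mathbb S_D(B,\mathcal U)$ has Lebesgue measure zero in $\mathbb R^{d\times d}$.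
   Context: Here $\pi_p:\mathbb R^d\to\mathbb R^p$ is the projection on the first $p$ coordinates, $\lfloor\cdot\rfloor$ is the floor function acting componentwise, and $]-1,1[$ is the open interval. The initial state $x(0)\in\mathbb R^d$ is arbitrary. Uniform left invertibility. A pair of input strings $\{u(i)\}_{i\in\mathbb N},\{u'(i)\}_{i\in\mathbb N}$ in $\mathcal U$ is uniformly distinguishable in $k$ steps with waiting time $l$ if for all initial states $x(0),x'(0)\in\mathbb R^d$ and all $m>l$: $u(m)\neq u'(m)$ implies $[y(m+1),\dots,y(m+k)]\neq[y'(m+1),\dots,y'(m+k)]$, where $y$ is the output for initial state $x(0)$ and inputs $u$, and $y'$ is the output for initial state $x'(0)$ and inputs $u'$. The system is uniformly left invertible (ULI) in $k$ steps if there is a constant $l\in\mathbb N$ such that every pair of distinct input sequences is uniformly distinguishable in $k$ steps with waiting time $l$. It is ULI if it is ULI in $k$ steps for some $k$. Uniform left D-invertibility. The difference system is $z(k+1)=Az(k)+Bv(k)$ with $v(k)\in\mathcal V=\{u-u':u,u'\in\mathcal U\}$. A pair of input strings $\{u(i)\},\{u'(i)\}$ is uniformly D-distinguishable in $k$ steps with waiting time $l$ if for all $x(0),x'(0)\in\mathbb R^d$ and all $m>l$, setting $z(0)=x(0)-x'(0)$, $v(i)=u(i)-u'(i)$ and letting $z$ be the resulting orbit of the difference system: $v(m)\neq0$ implies $(\pi_pz(m+1),\dots,\pi_pz(m+k))\notin(]-1,1[^p)^k$, i.e. $\pi_pz(m+j)\notin\,]-1,1[^p$ for some $1\le j\le k$.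 The system is uniformly left D-invertible (ULDI) in $k$ steps if there is a constant $l\in\mathbb N$ such that every pair of distinct input sequences is uniformly D-distinguishable in $k$ steps with waiting time $l$. It is ULDI if it is ULDI in $k$ steps for some $k$. Numbers $\alpha_1,\dots,\alpha_N\in\mathbb C$ form an algebraically independent set if $P(\alpha_1,\dots,\alpha_N)\neq0$ for every nonzero polynomial $P\in\mathbb Q[\zeta_1,\dots,\zeta_N]$. For the matrix $A$ this is required of the family of its $d^2$ entries. *)

theory Defs
  imports "HOL-Analysis.Analysis" "HOL-Library.Poly_Mapping"
begin

primrec state ::
  "real^'d^'d \<Rightarrow> real^'r^'d \<Rightarrow> real^'d \<Rightarrow> (nat \<Rightarrow> real^'r) \<Rightarrow> nat \<Rightarrow> real^'d"
where
  "state A B x0 u 0 = x0"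
| "state A B x0 u (Suc n) = A *v state A B x0 u n + B *v u n"

text \<open>The coordinates of a vector are ordered by the linear order of the finite index type, and
  for \<open>p \<le> CARD('d)\<close> the lists of length \<open>p\<close> represent the elements of \<open>p\<close>-dimensional space.\<close>

definition proj :: "nat \<Rightarrow> real^'d::{finite,linorder} \<Rightarrow> real list" where
  "proj p x = map (\<lambda>i. x $ i) (take p (sorted_list_of_set UNIV))"

definition out where
  "out p A B x0 u n = map floor (proj p (state A B x0 u n))"

definition open_cube :: "nat \<Rightarrow> real list set" where
  "open_cube p = {w. length w = p \<and> (\<forall>t\<in>set w. - 1 < t \<and> t < 1)}"

definition unif_distinguishable where
  "unif_distinguishable p A B k l u u' \<longleftrightarrow>
     (\<forall>x0 x0'. \<forall>m>l. u m \<noteq> u' m \<longrightarrow>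
        map (out p A B x0 u) [m+1..<m+k+1] \<noteq> map (out p A B x0' u') [m+1..<m+k+1])"

definition ULI_in where
  "ULI_in p A B U k \<longleftrightarrow>
     (\<exists>l. \<forall>u u'. range u \<subseteq> U \<and> range u' \<subseteq> U \<and> u \<noteq> u' \<longrightarrow> unif_distinguishable p A B k l u u')"

definition ULI where
  "ULI p A B U \<longleftrightarrow> (\<exists>k. ULI_in p A B U k)"

text \<open>The difference system has the same matrices as the original one, so its orbits are
  given by \<open>state\<close> with input string \<open>v i = u i - u' i\<close>.\<close>

definition unif_D_distinguishable where
  "unif_D_distinguishable p A B k l u u' \<longleftrightarrow>
     (\<forall>x0 x0'. \<forall>m>l.
        let v = (\<lambda>i. u i - u' i); z = state A B (x0 - x0') v
        in v m \<noteq> 0 \<longrightarrow> (\<exists>j\<in>{1..k}. proj p (z (m + j)) \<notin> open_cube p))"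

definition ULDI_in where
  "ULDI_in p A B U k \<longleftrightarrow>
     (\<exists>l. \<forall>u u'. range u \<subseteq> U \<and> range u' \<subseteq> U \<and> u \<noteq> u' \<longrightarrow> unif_D_distinguishable p A B k l u u')"

definition ULDI where
  "ULDI p A B U \<longleftrightarrow> (\<exists>k. ULDI_in p A B U k)"

definition S_ULI where
  "S_ULI p B U = {A. ULI p A B U}"

definition S_ULDI where
  "S_ULDI p B U = {A. ULDI p A B U}"

text \<open>A polynomial with rational coefficients in variables indexed by \<open>'i\<close> is a finitely
  supported map from exponent vectors (themselves finitely supported) to coefficients.\<close>

definition rat_mpoly_eval ::
  "(('i \<Rightarrow>\<^sub>0 nat) \<Rightarrow>\<^sub>0 rat) \<Rightarrow> ('i \<Rightarrow> complex) \<Rightarrow> complex"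
where
  "rat_mpoly_eval P \<alpha> =
     (\<Sum>e\<in>Poly_Mapping.keys P. of_rat (Poly_Mapping.lookup P e) *
        (\<Prod>i\<in>Poly_Mapping.keys e. \<alpha> i ^ Poly_Mapping.lookup e i))"

definition algebraically_independent :: "('i::finite \<Rightarrow> complex) \<Rightarrow> bool" where
  "algebraically_independent \<alpha> \<longleftrightarrow>
     (\<forall>P::('i \<Rightarrow>\<^sub>0 nat) \<Rightarrow>\<^sub>0 rat. P \<noteq> 0 \<longrightarrow> rat_mpoly_eval P \<alpha> \<noteq> 0)"

definition alg_indep_entries :: "real^'d^'d \<Rightarrow> bool" where
  "alg_indep_entries A \<longleftrightarrow>
     algebraically_independent (\<lambda>(i::'d, j::'d). complex_of_real (A $ i $ j))"

end

theory Submission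
  imports Defs
begin

text \<open>Two outputs that agree differ before rounding by less than one, so D-invertibility always implies
  invertibility. Conversely, write \<open>x (n) $ i\<close> as \<open>(e\<^sub>i\<^sup>T A^n) \<bullet> x\<^sub>0\<close> plus a constant. If the vectors
  \<open>e\<^sub>i\<^sup>T A^n\<close> are linearly independent over the integers, then by Kronecker's theorem the coordinates of
  finitely many states can be prescribed modulo one up to a small error, and a difference orbit inside
  the open cube is realised by two orbits with the same outputs.

  An integer relation between these vectors, evaluated at \<open>A + t I\<close>, has a coordinate that is a nonzero
  polynomial in \<open>t\<close>. Hence the relation is a nonzero polynomial in the entries of \<open>A\<close>, which excludes
  algebraically independent entries, and it holds for finitely many points on each line in direction
  \<open>I\<close>, so that by Tonelli's theorem it holds only on a null set.\<close>

section \<open>Null sets through their sections by parallel lines\<close>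

lemma countable_negligible_Union:
  assumes "countable F" "\<And>S. S \<in> F \<Longrightarrow> negligible (S :: 'a::euclidean_space set)"
  shows "negligible (\<Union>F)"
  using null_sets_UN'[of F "\<lambda>S. S" lebesgue] assms by (simp add: negligible_iff_null_sets)

text \<open>Tonelli for the indicator of \<open>x + t *\<^sub>R c \<in> S\<close>: integrating over
  \<open>t\<close> first gives 0, since countable sets are null; integrating over \<open>x\<close>
  first gives the measure of \<open>S\<close> for every \<open>t\<close>, by translation
  invariance.\<close>

lemma negligible_countable_lines:
  fixes S :: "'a::euclidean_space set"
  assumes S: "S \<in> sets borel" and lines: "\<And>x. countable {t::real. x + t *\<^sub>R c \<in> S}"
  shows "negligible S"
proof -
  define f where "f = (\<lambda>(t::real) (x::'a). indicator S (x + t *\<^sub>R c) :: ennreal)"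
  have f: "case_prod f \<in> borel_measurable (lborel \<Otimes>\<^sub>M lborel)"
    unfolding f_def using S by measurable
  have "(\<integral>\<^sup>+ t. f t x \<partial>lborel) = 0" for x
  proof -
    have "(\<integral>\<^sup>+ t. f t x \<partial>lborel) = (\<integral>\<^sup>+ t. indicator {t. x + t *\<^sub>R c \<in> S} t \<partial>lborel)"
      by (intro nn_integral_cong) (auto simp: f_def indicator_def)
    also have "\<dots> = emeasure lborel {t. x + t *\<^sub>R c \<in> S}"
      using measurable_sets_borel[of "\<lambda>t::real. x + t *\<^sub>R c" borel S] S
      by (intro nn_integral_indicator) (simp add: vimage_def)
    also have "\<dots> = 0"
      using lines by (rule emeasure_lborel_countable)
    finally show ?thesis .
  qed
  then have "(\<integral>\<^sup>+ x. (\<integral>\<^sup>+ t. f t x \<partial>lborel) \<partial>lborel) = 0"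
    by simp
  moreover have "(\<integral>\<^sup>+ x. f t x \<partial>lborel) = emeasure lborel S" for t
  proof -
    have "emeasure lborel S = (\<integral>\<^sup>+ x. indicator S x \<partial>distr lborel borel ((+) (t *\<^sub>R c)))"
      using S by (simp add: lborel_distr_plus)
    also have "\<dots> = (\<integral>\<^sup>+ x. f t x \<partial>lborel)"
      using S by (subst nn_integral_distr) (auto simp: f_def add.commute)
    finally show ?thesis ..
  qed
  ultimately have "(\<integral>\<^sup>+ t. emeasure lborel S \<partial>(lborel :: real measure)) = 0"
    using lborel_pair.Fubini'[OF f] by simp
  \<comment> \<open>A constant whose integral over a line of infinite length is 0 must be 0.\<close>
  then have "emeasure lborel S = 0"
    by (simp add: emeasure_lborel_UNIV)
  then show ?thesis
    using S by (simp add: negligible_iff_null_sets null_sets_completionI null_setsI)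
qed

section \<open>Kronecker's theorem for finite families\<close>

text \<open>Carries \<open>Kronecker_thm_1\<close>, stated for an initial segment of the naturals
  under injectivity and independence of the image, over to any finite index set. Independence of the
  family supplies both conditions.\<close>

lemma Kronecker_finite_family:
  fixes \<theta> \<alpha> :: "'i \<Rightarrow> real"
  assumes I: "finite I" and "\<epsilon> > 0"
    and indep: "\<And>c::'i \<Rightarrow> int. (\<Sum>i\<in>I. of_int (c i) * \<theta> i) = 0 \<Longrightarrow> \<forall>i\<in>I. c i = 0"
  obtains t h where "\<And>i. i \<in> I \<Longrightarrow> \<bar>t * \<theta> i - of_int (h i) - \<alpha> i\<bar> < \<epsilon>"
proof -
  \<comment> \<open>With the reals as a module over the integers, \<open>independent\<close> means
    that there is no integer relation.\<close>
  interpret Modules.module "(\<lambda>r. (*) (real_of_int r))"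
    by (simp add: Modules.module.intro distrib_left mult.commute)
  have inj: "inj_on \<theta> I"
  proof (rule inj_onI, rule ccontr)
    fix i j assume ij: "i \<in> I" "j \<in> I" "\<theta> i = \<theta> j" "i \<noteq> j"
    \<comment> \<open>Equal values at two indices give a relation with coefficients 1 and
      -1.\<close>
    define c :: "'i \<Rightarrow> int" where "c = (\<lambda>k. of_bool (k = i) - of_bool (k = j))"
    have "(\<Sum>k\<in>I. of_int (c k) * \<theta> k) =
        (\<Sum>k\<in>I. if k = i then \<theta> k else 0) - (\<Sum>k\<in>I. if k = j then \<theta> k else 0)"
      unfolding sum_subtractf[symmetric] by (intro sum.cong) (auto simp: c_def)
    also have "\<dots> = 0"
      using ij I by simp
    finally show False
      using indep[of c] ij by (auto simp: c_def)
  qed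
  have "independent (\<theta> ` I)"
  proof (subst dependent_finite)
    show "finite (\<theta> ` I)" using I by simp
    show "\<not> (\<exists>u. (\<exists>v\<in>\<theta> ` I. u v \<noteq> 0) \<and> (\<Sum>v\<in>\<theta> ` I. real_of_int (u v) * v) = 0)"
      using indep[of "\<lambda>i. _ (\<theta> i)"] by (auto simp: sum.reindex[OF inj])
  qed
  moreover obtain b where b: "bij_betw b {..<card I} I"
    using ex_bij_betw_nat_finite[OF I] by (auto simp: atLeast0LessThan)
  moreover have "(\<theta> \<circ> b) ` {..<card I} = \<theta> ` I" "inj_on (\<theta> \<circ> b) {..<card I}"
    using b inj unfolding image_comp[symmetric] by (auto simp: bij_betw_def intro: comp_inj_on)
  ultimately have "independent ((\<theta> \<circ> b) ` {..<card I})" "inj_on (\<theta> \<circ> b) {..<card I}"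
    by simp_all
  from Kronecker_thm_1[OF this \<open>\<epsilon> > 0\<close>, of "\<alpha> \<circ> b"]
  obtain t h where th: "\<And>n. n < card I \<Longrightarrow> \<bar>t * \<theta> (b n) - of_int (h n) - \<alpha> (b n)\<bar> < \<epsilon>"
    by auto
  show thesis
  proof (rule that[of t "h \<circ> the_inv_into {..<card I} b"])
    fix i assume "i \<in> I"
    then obtain n where "n < card I" "i = b n"
      using b by (auto simp: bij_betw_def)
    then show "\<bar>t * \<theta> i - of_int ((h \<circ> the_inv_into {..<card I} b) i) - \<alpha> i\<bar> < \<epsilon>"
      using th[of n] b by (simp add: bij_betw_def the_inv_into_f_f)
  qed
qed

text \<open>Relations are taken over the indices: for finite \<open>I\<close>, a repeated vector
  counts as dependence, which the image set alone would hide.\<close>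

definition int_independent_on :: "'i set \<Rightarrow> ('i \<Rightarrow> 'a::real_vector) \<Rightarrow> bool" where
  "int_independent_on I w \<longleftrightarrow>
     (\<forall>c::'i \<Rightarrow> int. (\<Sum>i\<in>I. of_int (c i) *\<^sub>R w i) = 0 \<longrightarrow> (\<forall>i\<in>I. c i = 0))"

text \<open>Fixing the coefficients outside \<open>I\<close> leaves countably many choices for
  finite \<open>I\<close>, so that the exceptional sets form a countable union.\<close>

lemma int_independent_on_iff_PiE:
  "int_independent_on I w \<longleftrightarrow>
     (\<forall>c\<in>(\<Pi>\<^sub>E i\<in>I. UNIV :: int set). (\<exists>i\<in>I. c i \<noteq> 0) \<longrightarrow> (\<Sum>i\<in>I. of_int (c i) *\<^sub>R w i) \<noteq> 0)"
  (is "_ \<longleftrightarrow> ?R")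
proof
  assume R: ?R
  show "int_independent_on I w"
    unfolding int_independent_on_def
  proof (intro allI impI)
    fix c :: "'a \<Rightarrow> int" assume "(\<Sum>i\<in>I. of_int (c i) *\<^sub>R w i) = 0"
    then show "\<forall>i\<in>I. c i = 0"
      using R[rule_format, of "restrict c I"] by (auto cong: sum.cong)
  qed
qed (auto simp: int_independent_on_def)

text \<open>A generic \<open>x\<close> avoids countably many hyperplanes, so that the numbers \<open>w i \<bullet> x\<close> are
  independent over the integers.\<close>

lemma Kronecker_vectors:
  fixes w :: "'i \<Rightarrow> 'a::euclidean_space" and \<epsilon> \<alpha> :: "'i \<Rightarrow> real"
  assumes I: "finite I" and \<epsilon>: "\<And>i. i \<in> I \<Longrightarrow> \<epsilon> i > 0" and indep: "int_independent_on I w"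
  obtains x h where "\<And>i. i \<in> I \<Longrightarrow> \<bar>w i \<bullet> x - of_int (h i) - \<alpha> i\<bar> < \<epsilon> i"
proof -
  define C where "C = {c \<in> (\<Pi>\<^sub>E i\<in>I. UNIV :: int set). \<exists>i\<in>I. c i \<noteq> 0}"
  define H where "H c = {x. (\<Sum>i\<in>I. of_int (c i) *\<^sub>R w i) \<bullet> x = 0}" for c :: "'i \<Rightarrow> int"
  have "countable C"
    unfolding C_def by (rule countable_subset[OF Collect_subset]) (simp add: countable_PiE I)
  moreover have "negligible (H c)" if "c \<in> C" for c
  proof -
    have "(\<Sum>i\<in>I. of_int (c i) *\<^sub>R w i) \<noteq> 0"
      using that indep by (auto simp: int_independent_on_iff_PiE C_def)
    then show ?thesis unfolding H_def by (intro negligible_hyperplane) simp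
  qed
  ultimately have "negligible (\<Union>(H ` C))"
    by (intro countable_negligible_Union) auto
  then obtain x where x: "\<And>c. c \<in> C \<Longrightarrow> x \<notin> H c"
    using non_negligible_UNIV by (metis UNIV_eq_I UN_I)
  have "(\<Sum>i\<in>I. of_int (c i) *\<^sub>R (w i \<bullet> x)) \<noteq> 0" if "c \<in> C" for c
    using x[OF that] by (simp add: H_def inner_sum_left)
  then have "int_independent_on I (\<lambda>i. w i \<bullet> x)"
    unfolding int_independent_on_iff_PiE C_def by blast
  then have ind: "\<forall>i\<in>I. c i = 0" if "(\<Sum>i\<in>I. of_int (c i) * (w i \<bullet> x)) = 0" for c :: "'i \<Rightarrow> int"
    using that by (auto simp: int_independent_on_def)
  \<comment> \<open>The theorem for real numbers has a single tolerance; the inserted 1 covers empty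
    \<open>I\<close>.\<close>
  define e where "e = Min (insert 1 (\<epsilon> ` I))"
  have e: "e > 0" "\<And>i. i \<in> I \<Longrightarrow> e \<le> \<epsilon> i"
    using \<epsilon> I by (auto simp: e_def)
  obtain t h where "\<And>i. i \<in> I \<Longrightarrow> \<bar>t * (w i \<bullet> x) - of_int (h i) - \<alpha> i\<bar> < e"
    using Kronecker_finite_family[where \<theta> = "\<lambda>i. w i \<bullet> x" and \<alpha> = \<alpha>, OF I e(1) ind] by blast
  with e(2) show thesis
    by (intro that[of "t *\<^sub>R x" h]) fastforce
qed

section \<open>Integer relations between rows of matrix powers\<close>

text \<open>This is row \<open>i\<close> of the \<open>n\<close>-th power of
  \<open>A\<close>.\<close>

definition row_power :: "real^'d^'d \<Rightarrow> 'd \<Rightarrow> nat \<Rightarrow> real^'d" where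
  "row_power A i n = ((\<lambda>v. v v* A) ^^ n) (axis i 1)"

lemma row_power_0: "row_power A i 0 $ l = of_bool (i = l)"
  by (simp add: row_power_def axis_def)

lemma row_power_Suc: "row_power A i (Suc n) $ l = (\<Sum>k\<in>UNIV. row_power A i n $ k * A $ k $ l)"
  by (simp add: row_power_def vector_matrix_mult_def)

lemma continuous_row_power: "continuous_on UNIV (\<lambda>A. row_power A i n)"
proof (induction n)
  case (Suc n)
  have "continuous_on UNIV (\<lambda>A. \<chi> l. row_power A i (Suc n) $ l)"
    unfolding row_power_Suc by (intro continuous_intros Suc)
  then show ?case by (simp add: vec_nth_inverse)
qed (simp add: row_power_def)

text \<open>The leading term of the \<open>n\<close>-th power of
  \<open>A + t *\<^sub>R mat 1\<close> is the identity times the \<open>n\<close>-th power of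
  \<open>t\<close>.\<close>

lemma row_power_line_poly:
  "\<exists>Q. (\<forall>t. poly Q t = row_power (A + t *\<^sub>R mat 1) i n $ l) \<and> degree Q \<le> n \<and>
       coeff Q n = of_bool (i = l)"
proof (induction n arbitrary: l)
  case 0
  show ?case by (intro exI[of _ "[:of_bool (i = l):]"]) (simp add: row_power_0)
next
  case (Suc n)
  then obtain Q where Q: "\<And>l t. poly (Q l) t = row_power (A + t *\<^sub>R mat 1) i n $ l"
    "\<And>l. degree (Q l) \<le> n" "\<And>l. coeff (Q l) n = of_bool (i = l)"
    by metis
  \<comment> \<open>One more factor \<open>A + t *\<^sub>R mat 1\<close> contributes column
    \<open>l\<close> of \<open>A\<close> and, from its diagonal, a shift of \<open>Q l\<close> by
    one degree.\<close>
  define R where "R = (\<Sum>k\<in>UNIV. smult (A $ k $ l) (Q k)) + pCons 0 (Q l)"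
  have "poly R t = row_power (A + t *\<^sub>R mat 1) i (Suc n) $ l" for t
  proof -
    have "row_power (A + t *\<^sub>R mat 1) i (Suc n) $ l =
        (\<Sum>k\<in>UNIV. poly (Q k) t * A $ k $ l) + (\<Sum>k\<in>UNIV. if k = l then poly (Q k) t * t else 0)"
      unfolding row_power_Suc sum.distrib[symmetric] Q(1)[symmetric]
      by (intro sum.cong) (auto simp: mat_def algebra_simps)
    then show ?thesis by (simp add: R_def poly_sum mult.commute)
  qed
  moreover have "degree R \<le> Suc n"
    unfolding R_def using Q(2)
    by (intro degree_add_le degree_sum_le order.trans[OF degree_smult_le] order.trans[OF degree_pCons_le])
       (auto intro: le_SucI)
  moreover have "coeff R (Suc n) = of_bool (i = l)"
  proof -
    have "coeff (Q k) (Suc n) = 0" for k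
      using Q(2)[of k] by (intro coeff_eq_0) simp
    then show ?thesis by (simp add: R_def coeff_sum Q(3))
  qed
  ultimately show ?case by blast
qed

text \<open>Take a coefficient with the highest power of \<open>A\<close>, and compare powers of \<open>t\<close>.\<close>

lemma finite_row_power_relation_line:
  fixes c :: "'d::finite \<times> nat \<Rightarrow> int"
  assumes "\<exists>i\<in>UNIV \<times> {..D}. c i \<noteq> 0"
  obtains l where
    "\<And>A. finite {t. (\<Sum>(i, n)\<in>UNIV \<times> {..D}. of_int (c (i, n)) *\<^sub>R row_power (A + t *\<^sub>R mat 1) i n) $ l = 0}"
proof -
  define N where "N = {n. n \<le> D \<and> (\<exists>l. c (l, n) \<noteq> 0)}"
  define m where "m = Max N"
  have "finite N" "N \<noteq> {}"
    using assms by (auto simp: N_def)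
  then have "m \<in> N" and max: "\<And>n. n \<in> N \<Longrightarrow> n \<le> m"
    by (auto simp: m_def)
  then obtain l where l: "m \<le> D" "c (l, m) \<noteq> 0"
    by (auto simp: N_def)
  show thesis
  \<comment> \<open>The choice of \<open>l\<close> depends on \<open>c\<close> alone, so one
    coordinate serves all matrices.\<close>
  proof (rule that[of l])
    fix A :: "real^'d^'d"
    obtain Q where Q: "\<And>i n t. poly (Q i n) t = row_power (A + t *\<^sub>R mat 1) i n $ l"
      "\<And>i n. degree (Q i n) \<le> n" "\<And>i n. coeff (Q i n) n = of_bool (i = l)"
      using row_power_line_poly[of A _ _ l] by metis
    define R where "R = (\<Sum>(i, n)\<in>UNIV \<times> {..D}. smult (of_int (c (i, n))) (Q i n))"
    have "coeff R m = (\<Sum>(i, n)\<in>UNIV \<times> {..D}. of_int (c (i, n)) * coeff (Q i n) m)"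
      by (simp add: R_def coeff_sum case_prod_unfold)
    \<comment> \<open>Terms with \<open>n < m\<close> have too small a degree, those with
      \<open>n > m\<close> vanish by maximality of \<open>m\<close>, and for \<open>n = m\<close>
      only \<open>i = l\<close> has a nonzero leading coefficient.\<close>
    also have "\<dots> = (\<Sum>x\<in>UNIV \<times> {..D}. if x = (l, m) then of_int (c x) else 0)"
    proof (intro sum.cong refl, clarify)
      fix i n assume "n \<le> D"
      consider "n < m" | "n = m" | "n > m" by linarith
      then show "of_int (c (i, n)) * coeff (Q i n) m =
          (if (i, n) = (l, m) then of_int (c (i, n)) else 0)"
      proof cases
        case 1
        then show ?thesis using Q(2)[of i n] by (auto simp: coeff_eq_0)
      next
        case 3
        then have "c (i, n) = 0" using max[of n] \<open>n \<le> D\<close> by (auto simp: N_def)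
        then show ?thesis using 3 by simp
      qed (simp add: Q(3))
    qed
    also have "\<dots> = of_int (c (l, m))"
      using l by (simp add: sum.delta)
    finally have "R \<noteq> 0"
      using l by auto
    then have "finite {t. poly R t = 0}"
      by (rule poly_roots_finite)
    then show "finite {t. (\<Sum>(i, n)\<in>UNIV \<times> {..D}. of_int (c (i, n)) *\<^sub>R row_power (A + t *\<^sub>R mat 1) i n) $ l = 0}"
      by (simp add: R_def poly_sum Q case_prod_unfold)
  qed
qed

text \<open>Every \<open>D\<close> is included because the observation window ends at
  \<open>m + k\<close> with \<open>m\<close> arbitrarily large.\<close>

definition int_independent_row_powers :: "real^'d^'d \<Rightarrow> bool" where
  "int_independent_row_powers A \<longleftrightarrow>
     (\<forall>D. int_independent_on (UNIV \<times> {..D}) (\<lambda>(i, n). row_power A i n))"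

text \<open>The exceptional set is a countable union of closed sets \<open>Z D c\<close>, each
  meeting every line in direction \<open>mat 1\<close> in finitely many points.\<close>

lemma negligible_dependent_row_powers:
  "negligible {A :: real^'d^'d. \<not> int_independent_row_powers A}"
proof -
  define C where "C D = {c \<in> (\<Pi>\<^sub>E i\<in>(UNIV :: 'd set) \<times> {..D}. UNIV :: int set). \<exists>i\<in>UNIV \<times> {..D}. c i \<noteq> 0}"
    for D :: nat
  define Z where "Z D c = {A :: real^'d^'d. (\<Sum>(i, n)\<in>UNIV \<times> {..D}. of_int (c (i, n)) *\<^sub>R row_power A i n) = 0}"
    for D and c :: "'d \<times> nat \<Rightarrow> int"
  have "negligible (Z D c)" if "c \<in> C D" for D c
  proof (rule negligible_countable_lines)
    have "continuous_on UNIV (\<lambda>A. \<Sum>(i, n)\<in>UNIV \<times> {..D}. of_int (c (i, n)) *\<^sub>R row_power A i n)"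
      unfolding case_prod_unfold by (intro continuous_intros continuous_row_power)
    then show "Z D c \<in> sets borel"
      unfolding Z_def by (intro borel_closed closed_Collect_eq) auto
    fix A :: "real^'d^'d"
    have "\<exists>i\<in>UNIV \<times> {..D}. c i \<noteq> 0"
      using that by (simp add: C_def)
    obtain l where "finite {t. (\<Sum>(i, n)\<in>UNIV \<times> {..D}. of_int (c (i, n)) *\<^sub>R row_power (A + t *\<^sub>R mat 1) i n) $ l = 0}"
      using finite_row_power_relation_line[of D c] \<open>\<exists>i\<in>UNIV \<times> {..D}. c i \<noteq> 0\<close> by blast
    then have "finite {t. A + t *\<^sub>R mat 1 \<in> Z D c}"
      by (rule rev_finite_subset) (auto simp: Z_def simp del: sum_component)
    then show "countable {t. A + t *\<^sub>R mat 1 \<in> Z D c}"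
      by (rule countable_finite)
  qed
  moreover have "countable (C D)" for D
    unfolding C_def by (rule countable_subset[OF Collect_subset]) (simp add: countable_PiE)
  ultimately have "negligible (\<Union>(\<Union>D. Z D ` C D))"
    by (intro countable_negligible_Union) auto
  moreover have "\<exists>D. \<exists>c\<in>C D. A \<in> Z D c" if "\<not> int_independent_row_powers A" for A :: "real^'d^'d"
    using that unfolding int_independent_row_powers_def int_independent_on_iff_PiE C_def Z_def
    by (simp add: case_prod_unfold) blast
  ultimately show ?thesis
    by (elim negligible_subset) auto
qed

section \<open>Rational polynomials in the matrix entries\<close>

text \<open>The product runs over all variables, not just the support, so that adding exponents
  multiplies values factor by factor.\<close>

definition monomial_eval :: "('i \<Rightarrow>\<^sub>0 nat) \<Rightarrow> ('i::finite \<Rightarrow> complex) \<Rightarrow> complex" where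
  "monomial_eval e \<alpha> = (\<Prod>i\<in>UNIV. \<alpha> i ^ Poly_Mapping.lookup e i)"

text \<open>Allows several polynomials to be summed over one common set of exponents.\<close>

lemma rat_mpoly_eval_superset:
  fixes P :: "('i::finite \<Rightarrow>\<^sub>0 nat) \<Rightarrow>\<^sub>0 rat"
  assumes "finite K" "Poly_Mapping.keys P \<subseteq> K"
  shows "rat_mpoly_eval P \<alpha> = (\<Sum>e\<in>K. of_rat (Poly_Mapping.lookup P e) * monomial_eval e \<alpha>)"
proof -
  have "(\<Prod>i\<in>Poly_Mapping.keys e. \<alpha> i ^ Poly_Mapping.lookup e i) = monomial_eval e \<alpha>" for e
    unfolding monomial_eval_def by (intro prod.mono_neutral_left) (auto simp: in_keys_iff)
  then have "rat_mpoly_eval P \<alpha> =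
      (\<Sum>e\<in>Poly_Mapping.keys P. of_rat (Poly_Mapping.lookup P e) * monomial_eval e \<alpha>)"
    by (simp add: rat_mpoly_eval_def)
  also have "\<dots> = (\<Sum>e\<in>K. of_rat (Poly_Mapping.lookup P e) * monomial_eval e \<alpha>)"
    using assms by (intro sum.mono_neutral_left) (auto simp: in_keys_iff)
  finally show ?thesis .
qed

lemma rat_mpoly_eval_zero: "rat_mpoly_eval 0 \<alpha> = 0"
  by (simp add: rat_mpoly_eval_def)

lemma rat_mpoly_eval_add:
  fixes P Q :: "('i::finite \<Rightarrow>\<^sub>0 nat) \<Rightarrow>\<^sub>0 rat"
  shows "rat_mpoly_eval (P + Q) \<alpha> = rat_mpoly_eval P \<alpha> + rat_mpoly_eval Q \<alpha>"
proof -
  let ?K = "Poly_Mapping.keys P \<union> Poly_Mapping.keys Q"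
  have "rat_mpoly_eval (P + Q) \<alpha> =
      (\<Sum>e\<in>?K. of_rat (Poly_Mapping.lookup (P + Q) e) * monomial_eval e \<alpha>)"
    by (intro rat_mpoly_eval_superset) (auto simp: Poly_Mapping.keys_add)
  then show ?thesis
    by (simp add: rat_mpoly_eval_superset[of ?K] lookup_add of_rat_add distrib_right sum.distrib)
qed

lemma rat_mpoly_eval_sum:
  fixes P :: "'j \<Rightarrow> ('i::finite \<Rightarrow>\<^sub>0 nat) \<Rightarrow>\<^sub>0 rat"
  shows "rat_mpoly_eval (\<Sum>j\<in>J. P j) \<alpha> = (\<Sum>j\<in>J. rat_mpoly_eval (P j) \<alpha>)"
  by (induction J rule: infinite_finite_induct) (auto simp: rat_mpoly_eval_add rat_mpoly_eval_zero)

lemma rat_mpoly_eval_single: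
  fixes e :: "'i::finite \<Rightarrow>\<^sub>0 nat"
  shows "rat_mpoly_eval (Poly_Mapping.single e a) \<alpha> = of_rat a * monomial_eval e \<alpha>"
  by (subst rat_mpoly_eval_superset[of "{e}"]) auto

lemma rat_mpoly_eval_mult_var:
  fixes P :: "('i::finite \<Rightarrow>\<^sub>0 nat) \<Rightarrow>\<^sub>0 rat"
  shows "\<exists>Q. \<forall>\<alpha>. rat_mpoly_eval Q \<alpha> = of_rat a * rat_mpoly_eval P \<alpha> * \<alpha> i"
proof -
  \<comment> \<open>Each exponent is raised by one at \<open>i\<close>; a sum of single terms is
    evaluated by additivity, without computing its support.\<close>
  let ?Q = "\<Sum>e\<in>Poly_Mapping.keys P.
    Poly_Mapping.single (e + Poly_Mapping.single i 1) (a * Poly_Mapping.lookup P e)"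
  have "monomial_eval (e + Poly_Mapping.single i 1) \<alpha> = monomial_eval e \<alpha> * \<alpha> i" for e \<alpha>
  proof -
    have "(\<Prod>j\<in>UNIV. \<alpha> j ^ Poly_Mapping.lookup (Poly_Mapping.single i 1) j) =
        (\<Prod>j\<in>UNIV. if i = j then \<alpha> j else 1)"
      by (intro prod.cong) (auto simp: lookup_single)
    then show ?thesis
      by (simp add: monomial_eval_def lookup_add power_add prod.distrib)
  qed
  then have "rat_mpoly_eval ?Q \<alpha> = of_rat a * rat_mpoly_eval P \<alpha> * \<alpha> i" for \<alpha>
    by (simp add: rat_mpoly_eval_sum rat_mpoly_eval_single rat_mpoly_eval_superset[OF _ order.refl]
        of_rat_mult sum_distrib_left sum_distrib_right mult_ac)
  then show ?thesis by blast
qed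

lemma rat_mpoly_eval_scale:
  fixes P :: "('i::finite \<Rightarrow>\<^sub>0 nat) \<Rightarrow>\<^sub>0 rat"
  shows "\<exists>Q. \<forall>\<alpha>. rat_mpoly_eval Q \<alpha> = of_rat a * rat_mpoly_eval P \<alpha>"
proof -
  let ?Q = "\<Sum>e\<in>Poly_Mapping.keys P. Poly_Mapping.single e (a * Poly_Mapping.lookup P e)"
  have "rat_mpoly_eval ?Q \<alpha> = of_rat a * rat_mpoly_eval P \<alpha>" for \<alpha>
    by (simp add: rat_mpoly_eval_sum rat_mpoly_eval_single rat_mpoly_eval_superset[OF _ order.refl]
        of_rat_mult sum_distrib_left mult_ac)
  then show ?thesis by blast
qed

text \<open>Only existence of \<open>P\<close> is recorded: the closure rules below recognise a
  relation as polynomial without computing its coefficients.\<close>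

definition rat_polynomial_in_entries :: "(real^'d^'d \<Rightarrow> real) \<Rightarrow> bool" where
  "rat_polynomial_in_entries f \<longleftrightarrow>
     (\<exists>P. \<forall>A. complex_of_real (f A) = rat_mpoly_eval P (\<lambda>(i, j). complex_of_real (A $ i $ j)))"

lemma rat_polynomial_in_entries_sum:
  assumes "\<And>j. j \<in> J \<Longrightarrow> rat_polynomial_in_entries (f j)"
  shows "rat_polynomial_in_entries (\<lambda>A. \<Sum>j\<in>J. f j A)"
proof -
  obtain P where "\<And>j A. j \<in> J \<Longrightarrow>
      complex_of_real (f j A) = rat_mpoly_eval (P j) (\<lambda>(i, j). complex_of_real (A $ i $ j))"
    using assms unfolding rat_polynomial_in_entries_def by metis
  then show ?thesis
    unfolding rat_polynomial_in_entries_def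
    by (intro exI[of _ "\<Sum>j\<in>J. P j"]) (simp add: rat_mpoly_eval_sum)
qed

lemma rat_polynomial_in_entries_mult_entry:
  assumes "rat_polynomial_in_entries f"
  shows "rat_polynomial_in_entries (\<lambda>A. f A * A $ k $ l)"
proof -
  obtain P where P: "\<And>A. complex_of_real (f A) = rat_mpoly_eval P (\<lambda>(i, j). complex_of_real (A $ i $ j))"
    using assms unfolding rat_polynomial_in_entries_def by metis
  obtain Q where "\<And>\<alpha>. rat_mpoly_eval Q \<alpha> = rat_mpoly_eval P \<alpha> * \<alpha> (k, l)"
    using rat_mpoly_eval_mult_var[of 1 P "(k, l)"] by auto
  then show ?thesis
    unfolding rat_polynomial_in_entries_def by (intro exI[of _ Q]) (simp add: P)
qed

lemma rat_polynomial_in_entries_scale: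
  assumes "rat_polynomial_in_entries f"
  shows "rat_polynomial_in_entries (\<lambda>A. of_int a * f A)"
proof -
  obtain P where P: "\<And>A. complex_of_real (f A) = rat_mpoly_eval P (\<lambda>(i, j). complex_of_real (A $ i $ j))"
    using assms unfolding rat_polynomial_in_entries_def by metis
  obtain Q where "\<And>\<alpha>. rat_mpoly_eval Q \<alpha> = of_int a * rat_mpoly_eval P \<alpha>"
    using rat_mpoly_eval_scale[of "of_int a" P] by auto
  then show ?thesis
    unfolding rat_polynomial_in_entries_def by (intro exI[of _ Q]) (simp add: P)
qed

lemma rat_polynomial_in_entries_row_power:
  "rat_polynomial_in_entries (\<lambda>A. row_power A i n $ l)"
proof (induction n arbitrary: l)
  case 0
  show ?case
    unfolding rat_polynomial_in_entries_def row_power_0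
    by (intro exI[of _ "Poly_Mapping.single 0 (of_bool (i = l))"])
       (simp add: rat_mpoly_eval_single monomial_eval_def)
next
  case (Suc n)
  then show ?case
    unfolding row_power_Suc
    by (intro rat_polynomial_in_entries_sum rat_polynomial_in_entries_mult_entry)
qed

text \<open>That the polynomial is nonzero is not read off its coefficients: otherwise the relation
  would vanish in coordinate \<open>l\<close> at every matrix, hence along a whole line.\<close>

lemma alg_indep_entries_imp_int_independent_row_powers:
  fixes A :: "real^'d^'d"
  assumes "alg_indep_entries A"
  shows "int_independent_row_powers A"
proof (rule ccontr)
  assume "\<not> int_independent_row_powers A"
  then obtain D and c :: "'d \<times> nat \<Rightarrow> int" where c: "\<exists>i\<in>UNIV \<times> {..D}. c i \<noteq> 0"
    and zero: "(\<Sum>(i, n)\<in>UNIV \<times> {..D}. of_int (c (i, n)) *\<^sub>R row_power A i n) = 0"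
    by (auto simp: int_independent_row_powers_def int_independent_on_def case_prod_unfold)
  define F where "F M = (\<Sum>(i, n)\<in>UNIV \<times> {..D}. of_int (c (i, n)) *\<^sub>R row_power M i n)"
    for M :: "real^'d^'d"
  obtain l where fin: "\<And>M. finite {t. F (M + t *\<^sub>R mat 1) $ l = 0}"
    using finite_row_power_relation_line[OF c] unfolding F_def by blast
  have "rat_polynomial_in_entries (\<lambda>M. F M $ l)"
    unfolding F_def sum_component case_prod_unfold vector_scaleR_component real_scaleR_def
    by (intro rat_polynomial_in_entries_sum rat_polynomial_in_entries_scale
        rat_polynomial_in_entries_row_power)
  then obtain P where P: "\<And>M. complex_of_real (F M $ l) =
      rat_mpoly_eval P (\<lambda>(i, j). complex_of_real (M $ i $ j))"
    unfolding rat_polynomial_in_entries_def by blast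
  have "F A $ l = 0"
    using zero by (simp add: F_def)
  then have "P = 0"
    using P[of A] assms by (auto simp: alg_indep_entries_def algebraically_independent_def)
  then have "F M $ l = 0" for M
    using P[of M] by (simp add: rat_mpoly_eval_zero)
  with fin[of 0] show False
    using infinite_UNIV_char_0[where 'a = real] by simp
qed

section \<open>Orbits and the two kinds of distinguishability\<close>

lemma state_diff:
  "state A B x u n - state A B x' u' n = state A B (x - x') (\<lambda>i. u i - u' i) n"
proof (induction n)
  case (Suc n)
  then show ?case
    by (simp add: matrix_vector_mult_diff_distrib flip: Suc.IH)
qed simp

text \<open>Separates the functional of the initial state, which Kronecker's theorem controls, from
  the fixed contribution of the inputs.\<close>

lemma state_component:
  "state A B x u n $ i = row_power A i n \<bullet> x + state A B 0 u n $ i"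
proof -
  \<comment> \<open>The vector \<open>w\<close> is arbitrary because the induction step passes from
    \<open>w\<close> to \<open>w v* A\<close>.\<close>
  have "w \<bullet> ((*v) A ^^ n) x = ((\<lambda>v. v v* A) ^^ n) w \<bullet> x" for w
  proof (induction n arbitrary: w)
    case (Suc n)
    then show ?case
      using funpow_swap1[of "\<lambda>v. v v* A" n w] by (simp flip: dot_lmul_matrix)
  qed simp
  from this[of "axis i 1"] have "row_power A i n \<bullet> x = ((*v) A ^^ n) x $ i"
    by (simp add: row_power_def inner_axis' )
  moreover have "state A B x u n = ((*v) A ^^ n) x + state A B 0 u n"
    by (induction n) (simp_all add: matrix_vector_right_distrib)
  ultimately show ?thesis by simp
qed

definition coords :: "nat \<Rightarrow> 'd::{finite,linorder} set" where
  "coords p = set (take p (sorted_list_of_set UNIV))"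

lemma proj_in_open_cube_iff:
  fixes x :: "real^'d::{finite,linorder}"
  assumes "p \<le> CARD('d)"
  shows "proj p x \<in> open_cube p \<longleftrightarrow> (\<forall>i\<in>coords p. \<bar>x $ i\<bar> < 1)"
  using assms by (auto simp: proj_def open_cube_def coords_def)

lemma out_eq_iff:
  "out p A B x u n = out p A B x' u' n \<longleftrightarrow>
     (\<forall>i\<in>coords p. \<lfloor>state A B x u n $ i\<rfloor> = \<lfloor>state A B x' u' n $ i\<rfloor>)"
  by (auto simp: out_def proj_def coords_def)

lemma unif_D_distinguishable_imp_unif_distinguishable:
  fixes A :: "real^'d::{finite,linorder}^'d::{finite,linorder}"
  assumes p: "p \<le> CARD('d)" and D: "unif_D_distinguishable p A B k l u u'"
  shows "unif_distinguishable p A B k l u u'"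
  unfolding unif_distinguishable_def
proof (intro allI impI notI)
  fix x0 x0' m assume "l < m" "u m \<noteq> u' m"
    and eq: "map (out p A B x0 u) [m+1..<m+k+1] = map (out p A B x0' u') [m+1..<m+k+1]"
  then obtain j where j: "j \<in> {1..k}"
    "proj p (state A B (x0 - x0') (\<lambda>i. u i - u' i) (m + j)) \<notin> open_cube p"
    using D unfolding unif_D_distinguishable_def Let_def by force
  then obtain i where i: "i \<in> coords p"
    "\<not> \<bar>state A B x0 u (m + j) $ i - state A B x0' u' (m + j) $ i\<bar> < 1"
    unfolding proj_in_open_cube_iff[OF p] state_diff[symmetric] by auto
  have "m + j \<in> set [m+1..<m+k+1]"
    using j(1) by auto
  with eq have "out p A B x0 u (m + j) = out p A B x0' u' (m + j)"
    by (simp only: map_eq_conv)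
  then have "\<lfloor>state A B x0 u (m + j) $ i\<rfloor> = \<lfloor>state A B x0' u' (m + j) $ i\<rfloor>"
    using i by (simp add: out_eq_iff)
  with i(2) show False by linarith
qed

text \<open>If the difference orbit \<open>z\<close> stays in the open cube, Kronecker's theorem provides a new initial
  state for which each relevant coordinate is near \<open>(1 + z) / 2\<close> modulo one, so that subtracting
  \<open>z\<close> changes no integer part.\<close>

lemma unif_distinguishable_imp_unif_D_distinguishable:
  fixes A :: "real^'d::{finite,linorder}^'d::{finite,linorder}"
  assumes p: "p \<le> CARD('d)" and ind: "int_independent_row_powers A"
    and dist: "unif_distinguishable p A B k l u u'"
  shows "unif_D_distinguishable p A B k l u u'"
  unfolding unif_D_distinguishable_def Let_def
proof (intro allI impI, rule ccontr)
  fix x0 x0' :: "real^'d::{finite,linorder}" and m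
  define z where "z = state A B (x0 - x0') (\<lambda>i. u i - u' i)"
  assume m: "l < m" "u m - u' m \<noteq> 0"
    and "\<not> (\<exists>j\<in>{1..k}. proj p (state A B (x0 - x0') (\<lambda>i. u i - u' i) (m + j)) \<notin> open_cube p)"
  then have cube: "\<And>j i. j \<in> {1..k} \<Longrightarrow> i \<in> coords p \<Longrightarrow> \<bar>z (m + j) $ i\<bar> < 1"
    by (auto simp: proj_in_open_cube_iff[OF p] z_def)
  \<comment> \<open>The numbers \<open>s\<close> with both \<open>s\<close> and
    \<open>s - z n $ i\<close> in the open unit interval form an interval with centre
    \<open>(1 + z n $ i) / 2\<close> and this half-length. The value 1 only keeps the tolerance
    positive where \<open>z\<close> leaves the cube.\<close>
  define \<epsilon> where "\<epsilon> = (\<lambda>(i, n). if \<bar>z n $ i\<bar> < 1 then (1 - \<bar>z n $ i\<bar>) / 2 else 1)"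
  \<comment> \<open>The input contribution is subtracted, since only the initial state is being
    chosen.\<close>
  define \<alpha> where "\<alpha> = (\<lambda>(i, n). (1 + z n $ i) / 2 - state A B 0 u n $ i)"
  have fin: "finite ((UNIV :: 'd::{finite,linorder} set) \<times> {..m + k})" by simp
  have pos: "\<epsilon> q > 0" for q
    by (auto simp: \<epsilon>_def split: prod.split)
  obtain y h where yh: "\<And>q. q \<in> UNIV \<times> {..m + k} \<Longrightarrow>
      \<bar>(case q of (i, n) \<Rightarrow> row_power A i n) \<bullet> y - of_int (h q) - \<alpha> q\<bar> < \<epsilon> q"
    using Kronecker_vectors[where \<epsilon> = \<epsilon> and \<alpha> = \<alpha>,
        OF fin pos ind[unfolded int_independent_row_powers_def, rule_format]]
    by blast
  \<comment> \<open>This choice gives the new pair of orbits the same difference \<open>z\<close> as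
    the original pair.\<close>
  define y' where "y' = y - (x0 - x0')"
  have diff: "state A B y' u' n = state A B y u n - z n" for n
    using state_diff[of A B y u n y' u'] by (simp add: y'_def z_def algebra_simps)
  have "out p A B y u n = out p A B y' u' n" if n: "n \<in> set [m+1..<m+k+1]" for n
    unfolding out_eq_iff
  proof
    fix i :: "'d::{finite,linorder}" assume i: "i \<in> coords p"
    have "n - m \<in> {1..k}" "m + (n - m) = n"
      using n by auto
    then have z: "\<bar>z n $ i\<bar> < 1"
      using cube[of "n - m" i] i by simp
    have "\<bar>row_power A i n \<bullet> y - of_int (h (i, n)) - \<alpha> (i, n)\<bar> < \<epsilon> (i, n)"
      using yh[of "(i, n)"] n by auto
    then have "\<bar>state A B y u n $ i - of_int (h (i, n)) - (1 + z n $ i) / 2\<bar> < (1 - \<bar>z n $ i\<bar>) / 2"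
      using z unfolding state_component[of A B y] by (simp add: \<alpha>_def \<epsilon>_def algebra_simps)
    then have "\<lfloor>state A B y u n $ i\<rfloor> = h (i, n)" "\<lfloor>state A B y u n $ i - z n $ i\<rfloor> = h (i, n)"
      by (auto simp: floor_eq_iff abs_if field_simps split: if_splits)
    then show "\<lfloor>state A B y u n $ i\<rfloor> = \<lfloor>state A B y' u' n $ i\<rfloor>"
      by (simp add: diff)
  qed
  then have "map (out p A B y u) [m+1..<m+k+1] = map (out p A B y' u') [m+1..<m+k+1]"
    by (intro map_cong) auto
  moreover have "u m \<noteq> u' m"
    using m by simp
  ultimately show False
    using dist m unfolding unif_distinguishable_def by blast
qed

lemma ULDI_imp_ULI:
  fixes A :: "real^'d::{finite,linorder}^'d::{finite,linorder}"
  assumes "p \<le> CARD('d)" "ULDI p A B U"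
  shows "ULI p A B U"
  using assms unfolding ULDI_def ULI_def ULDI_in_def ULI_in_def
  by (meson unif_D_distinguishable_imp_unif_distinguishable)

text \<open>The same \<open>k\<close> and \<open>l\<close> serve for both properties.\<close>

lemma ULI_imp_ULDI:
  fixes A :: "real^'d::{finite,linorder}^'d::{finite,linorder}"
  assumes "p \<le> CARD('d)" "int_independent_row_powers A" "ULI p A B U"
  shows "ULDI p A B U"
  using assms unfolding ULDI_def ULI_def ULDI_in_def ULI_in_def
  by (meson unif_distinguishable_imp_unif_D_distinguishable)

theorem theorem6:
  fixes p :: nat
    and B :: "real^'r^'d::{finite,linorder}"
    and U :: "(real^'r) set"
  assumes "1 \<le> p" and "p \<le> CARD('d)" and "finite U"
  shows "(\<forall>A :: real^'d::{finite,linorder}^'d::{finite,linorder}. alg_indep_entries A \<longrightarrow> (ULDI p A B U \<longleftrightarrow> ULI p A B U)) \<and>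
         S_ULI p B U - S_ULDI p B U \<in> null_sets lebesgue"
proof
  show "\<forall>A :: real^'d::{finite,linorder}^'d::{finite,linorder}. alg_indep_entries A \<longrightarrow> (ULDI p A B U \<longleftrightarrow> ULI p A B U)"
    using ULDI_imp_ULI ULI_imp_ULDI alg_indep_entries_imp_int_independent_row_powers assms(2) by blast
  have "S_ULI p B U - S_ULDI p B U \<subseteq> {A. \<not> int_independent_row_powers A}"
    using ULI_imp_ULDI[OF assms(2)] by (auto simp: S_ULI_def S_ULDI_def)
  then show "S_ULI p B U - S_ULDI p B U \<in> null_sets lebesgue"
    using negligible_dependent_row_powers negligible_subset negligible_iff_null_sets by blast
qed

end
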